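(* Suppose that $(X,T)$ is a dynamical system with $\sharp \mathcal{M}_{dense}^*>1$. Then there exist a residual invariant subset $Y\subset X$ and an open and dense subset $\mathfrak{U}\subset C(X)$ such that for any $x\in Y$ and any $f\in \mathfrak{U}$ one has (1) $\mathcal{M}_{dense}^*\subset V_T(x)$; (2) $\underline{f}(x)\leq \inf_{\mu\in \mathcal{M}_{dense}^*}\int f\, d\mu<\sup_{\mu\in \mathcal{M}_{dense}^*}\int f\, d\mu\leq \overline{f}(x)$; (3) $V_T(x)\cap \mathcal{O}_{T}\neq\emptyset$ provided that $X=M$ is a manifold.
   Context: $(X,d)$ is a compact metric space, $T:X\to X$ is continuous, and $(X,T)$ is called a dynamical system. $\mathcal{M}(X)$ and $\mathcal{M}(X,T)$ are the spaces of Borel probability measures and of $T$-invariant Borel probability measures, with the weak* topology. $C(X)$ is the space of real continuous functions with the sup norm. A set is residual if it contains a dense $G_\delta$ subset. Fix a countable set $\{f_i\}_{i\ge1}\subset C(X)$ with $\|f_i\|=1$ such that $\rho(\mu_1,\mu_2)=\sum_{i\ge 1}2^{-i}|\int f_i d\mu_1-\int f_i d\mu_2|$ is a metric for the weak* topology on $\mathcal{M}(X)$. For $x\in X$, $V_T(x)$ is the set of weak* accumulation points of $\frac1n\sum_{i=0}^{n-1}\delta_{T^ix}$ as $n\to\infty$. For $\mu\in\mathcal{M}(X,T)$ and $\varepsilon>0$, $G^\mu_\varepsilon=\{x\in X\mid \rho(\mu,V_T(x))\le\varepsilon\}$, where $\rho(\mu,V_T(x))=\inf_{\nu\in V_T(x)}\rho(\mu,\nu)$.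 Define $\mathcal{M}_{dense}^*=\{\mu\in\mathcal{M}(X,T)\mid G^\mu_\varepsilon\text{ is dense in }X\text{ for any }\varepsilon>0\}$. For $f\in C(X)$, $\underline{f}(x)=\liminf_{n\to\infty}\frac1n\sum_{i=0}^{n-1}f(T^ix)$ and $\overline{f}(x)=\limsup_{n\to\infty}\frac1n\sum_{i=0}^{n-1}f(T^ix)$. If $X=M$ is a manifold, a probability measure $\mu\in\mathcal{M}(X)$ is called physical-like if for every $\varepsilon>0$ the set $G^\mu_\varepsilon$ (defined by the same formula) has positive Lebesgue measure; $\mathcal{O}_T$ denotes the set of physical-like measures of $T$. *)

theory Defs
  imports "HOL-Probability.Probability"
begin

definition prob_measures :: "'a::topological_space measure set" where
  "prob_measures = {\<mu>. prob_space \<mu> \<and> sets \<mu> = sets borel}"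

definition invariant_measures :: "('a::topological_space \<Rightarrow> 'a) \<Rightarrow> 'a measure set" where
  "invariant_measures T = {\<mu> \<in> prob_measures. distr \<mu> borel T = \<mu>}"

text \<open>The weak* topology: the coarsest topology on the probability measures making every
  \<open>\<mu> \<mapsto> \<integral>f d\<mu>\<close> continuous. On a compact space the type \<open>'a \<Rightarrow>\<^sub>C real\<close> of bounded continuous
  functions, with its sup norm, is C(X).\<close>

definition weak_star :: "'a::topological_space measure topology" where
  "weak_star = topology_generated_by
     {{\<mu> \<in> prob_measures. (\<integral>y. apply_bcontfun f y \<partial>\<mu>) \<in> U} | (f :: 'a \<Rightarrow>\<^sub>C real) U. open U}"

text \<open>The sequence \<open>F 0, F 1, \<dots>\<close> lists \<open>f\<^sub>1, f\<^sub>2, \<dots>\<close>. The value 0 outside the probability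
  measures is immaterial: it is there only because \<open>Metric_space\<close> asks for nonnegativity and
  symmetry on the whole type.\<close>

definition rho :: "(nat \<Rightarrow> ('a::topological_space \<Rightarrow>\<^sub>C real)) \<Rightarrow> 'a measure \<Rightarrow> 'a measure \<Rightarrow> real" where
  "rho F \<mu> \<nu> =
     (if \<mu> \<in> prob_measures \<and> \<nu> \<in> prob_measures
      then \<Sum>i. \<bar>(\<integral>y. apply_bcontfun (F i) y \<partial>\<mu>) - (\<integral>y. apply_bcontfun (F i) y \<partial>\<nu>)\<bar> / 2 ^ Suc i
      else 0)"

definition metrizing_family :: "(nat \<Rightarrow> ('a::topological_space \<Rightarrow>\<^sub>C real)) \<Rightarrow> bool" where
  "metrizing_family F \<longleftrightarrow>
     (\<forall>i. norm (F i) = 1) \<and>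
     Metric_space prob_measures (rho F) \<and>
     Metric_space.mtopology prob_measures (rho F) = weak_star"

text \<open>The empirical measure \<open>1/n \<Sum>i<n. \<delta>(T\<^sup>i x)\<close>, as the image of the uniform distribution on
  \<open>{..<n}\<close> under \<open>i \<mapsto> T\<^sup>i x\<close> (for \<open>n = 0\<close> it is the zero measure, which plays no role in limits).\<close>

definition empirical :: "('a::topological_space \<Rightarrow> 'a) \<Rightarrow> 'a \<Rightarrow> nat \<Rightarrow> 'a measure" where
  "empirical T x n = distr (uniform_count_measure {..<n}) borel (\<lambda>i. (T ^^ i) x)"

lemma integral_empirical:
  fixes f :: "'a::topological_space \<Rightarrow> real"
  assumes "f \<in> borel_measurable borel"
  shows "(\<integral>y. f y \<partial>empirical T x n) = (\<Sum>i<n. f ((T ^^ i) x)) / real n"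
proof -
  have "(\<lambda>i. (T ^^ i) x) \<in> measurable (uniform_count_measure {..<n}) borel"
    by (simp add: measurable_def sets_uniform_count_measure space_uniform_count_measure)
  then show ?thesis
    using assms by (simp add: empirical_def integral_distr integral_uniform_count_measure)
qed

text \<open>Accumulation points are meant in the sense of a sequence: every neighbourhood of \<open>\<mu>\<close> is
  visited for infinitely many \<open>n\<close>.\<close>

definition V :: "('a::topological_space \<Rightarrow> 'a) \<Rightarrow> 'a \<Rightarrow> 'a measure set" where
  "V T x = {\<mu> \<in> prob_measures.
     \<forall>W. openin weak_star W \<and> \<mu> \<in> W \<longrightarrow> (\<exists>\<^sub>F n in sequentially. empirical T x n \<in> W)}"

definition G_set ::
  "(nat \<Rightarrow> ('a::topological_space \<Rightarrow>\<^sub>C real)) \<Rightarrow> ('a \<Rightarrow> 'a) \<Rightarrow> 'a measure \<Rightarrow> real \<Rightarrow> 'a set" where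
  "G_set F T \<mu> \<epsilon> = {x. (INF \<nu>\<in>V T x. rho F \<mu> \<nu>) \<le> \<epsilon>}"

definition M_dense ::
  "(nat \<Rightarrow> ('a::topological_space \<Rightarrow>\<^sub>C real)) \<Rightarrow> ('a \<Rightarrow> 'a) \<Rightarrow> 'a measure set" where
  "M_dense F T = {\<mu> \<in> invariant_measures T. \<forall>\<epsilon>>0. closure (G_set F T \<mu> \<epsilon>) = UNIV}"

definition birkhoff_avg :: "('a \<Rightarrow> 'a) \<Rightarrow> ('a \<Rightarrow> real) \<Rightarrow> 'a \<Rightarrow> nat \<Rightarrow> real" where
  "birkhoff_avg T f x n = (\<Sum>i<n. f ((T ^^ i) x)) / real n"

definition lower_avg :: "('a \<Rightarrow> 'a) \<Rightarrow> ('a \<Rightarrow> real) \<Rightarrow> 'a \<Rightarrow> ereal" where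
  "lower_avg T f x = liminf (\<lambda>n. ereal (birkhoff_avg T f x n))"

definition upper_avg :: "('a \<Rightarrow> 'a) \<Rightarrow> ('a \<Rightarrow> real) \<Rightarrow> 'a \<Rightarrow> ereal" where
  "upper_avg T f x = limsup (\<lambda>n. ereal (birkhoff_avg T f x n))"

definition residual :: "'a::topological_space set \<Rightarrow> bool" where
  "residual Y \<longleftrightarrow> (\<exists>D. gdelta D \<and> closure D = UNIV \<and> D \<subseteq> Y)"

definition C1_on :: "'b::euclidean_space set \<Rightarrow> ('b \<Rightarrow> 'b) \<Rightarrow> bool" where
  "C1_on S g \<longleftrightarrow>
     (\<exists>g' :: 'b \<Rightarrow> 'b \<Rightarrow>\<^sub>L 'b.
        (\<forall>u\<in>S. (g has_derivative blinfun_apply (g' u)) (at u)) \<and> continuous_on S g')"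

text \<open>A differentiable manifold structure (without boundary, modelled on \<open>'b\<close>) inducing the given
  topology: each pair consists of a chart domain and a chart. Smooth atlases are a special case;
  \<open>C\<^sup>1\<close> transition maps are what is needed for Lebesgue null sets to be well defined.\<close>

definition manifold_atlas ::
  "('a::topological_space set \<times> ('a \<Rightarrow> 'b::euclidean_space)) set \<Rightarrow> bool" where
  "manifold_atlas \<A> \<longleftrightarrow>
     (\<Union>(U, \<phi>)\<in>\<A>. U) = UNIV \<and>
     (\<forall>(U, \<phi>)\<in>\<A>. open U \<and> open (\<phi> ` U) \<and> homeomorphism U (\<phi> ` U) \<phi> (inv_into U \<phi>)) \<and>
     (\<forall>(U, \<phi>)\<in>\<A>. \<forall>(W, \<psi>)\<in>\<A>. C1_on (\<phi> ` (U \<inter> W)) (\<psi> \<circ> inv_into U \<phi>))"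

text \<open>Transition maps preserve null sets, so for Borel sets this depends only on the manifold
  structure and agrees with having positive measure for any Riemannian volume.\<close>

definition positive_lebesgue_measure ::
  "('a::topological_space set \<times> ('a \<Rightarrow> 'b::euclidean_space)) set \<Rightarrow> 'a set \<Rightarrow> bool" where
  "positive_lebesgue_measure \<A> S \<longleftrightarrow> (\<exists>(U, \<phi>)\<in>\<A>. emeasure lebesgue (\<phi> ` (S \<inter> U)) > 0)"

definition physical_like ::
  "(nat \<Rightarrow> ('a::topological_space \<Rightarrow>\<^sub>C real)) \<Rightarrow>
   ('a set \<times> ('a \<Rightarrow> 'b::euclidean_space)) set \<Rightarrow> ('a \<Rightarrow> 'a) \<Rightarrow> 'a measure set" where
  "physical_like F \<A> T =
     {\<mu> \<in> prob_measures. \<forall>\<epsilon>>0. positive_lebesgue_measure \<A> (G_set F T \<mu> \<epsilon>)}"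

end

theory Submission
  imports Defs
begin

text \<open>
  Everything rests on a description by visits. The empirical measures of a point \<open>x\<close> visit a
  weak* open set \<open>W\<close> infinitely often on a countable intersection of open sets of points, because the
  empirical measure at a fixed time depends continuously on \<open>x\<close>. If the points \<open>x\<close> for which \<open>V T x\<close> meets
  \<open>W\<close> are dense, each of these open sets is dense as well, and Baire's theorem produces a residual set
  of points visiting \<open>W\<close> infinitely often, simultaneously for countably many \<open>W\<close> (\<open>residual_visits\<close>).

  The space of probability measures is second countable and compact, so countably many \<open>W\<close> are enough to
  express both that \<open>V T x\<close> contains \<open>M_dense\<close> and that \<open>V T x\<close> meets the compact set of physical-like
  measures (\<open>residual_V\<close>). Density is by definition available for the neighbourhoods of a measure in
  \<open>M_dense\<close>. For the physical-like measures it is a Lindelof argument: the measures that are not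
  physical-like are covered by countably many balls, each of which is reached only from a Lebesgue
  null set of points, so in every nonempty open set there is a point none of whose accumulation
  measures lies in these balls (\<open>dense_V_meets_physical_like\<close>). The residual set is invariant because \<open>V T x\<close> does
  not change along the orbit (\<open>V_shift\<close>).

  The set \<open>\<UU>\<close> consists of the functions with different integrals against two fixed distinct measures
  \<open>\<mu>, \<nu>\<close> in \<open>M_dense\<close>; it is open by continuity and dense by linearity, and the strict inequality between infimum and
  supremum is immediate. The outer inequalities hold because each measure in \<open>V T x\<close> is a limit of
  empirical measures along a subsequence (\<open>V_averages_between\<close>).

  Compactness of the space of probability measures (\<open>prob_measures_seq_compact\<close>) is obtained from Helly's
  selection theorem on the real line. The points of \<open>X\<close> are coded by points of the Cantor set; the
  code is a Borel map whose inverse extends continuously to the closure of the set of codes, so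
  measures can be carried to the line and weak limits carried back.
\<close>

section \<open>Coding a compact metric space by points of the Cantor set\<close>

text \<open>The point of the middle-thirds Cantor set whose ternary digits are 2 where \<open>a\<close> holds and 0 elsewhere.\<close>

definition cantor_point :: "(nat \<Rightarrow> bool) \<Rightarrow> real" where
  "cantor_point a = (\<Sum>n. 2 * of_bool (a n) / 3 ^ Suc n)"

lemma geometric_third_sums: "(\<lambda>n. 2 / 3 ^ Suc n :: real) sums 1"
proof -
  have "(\<lambda>n. (2/3) * (1/3::real) ^ n) sums ((2/3) * (1 / (1 - 1/3)))"
    by (intro sums_mult geometric_sums) simp
  then show ?thesis by (simp add: power_one_over)
qed

lemma summable_cantor: "summable (\<lambda>n. 2 * of_bool (a n) / 3 ^ Suc n :: real)"
  by (rule summable_comparison_test[OF _ sums_summable[OF geometric_third_sums]])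
     (auto simp: of_bool_def)

lemma cantor_point_bounds: "0 \<le> cantor_point a" "cantor_point a \<le> 1"
proof -
  show "0 \<le> cantor_point a"
    unfolding cantor_point_def by (intro suminf_nonneg summable_cantor) simp
  have "cantor_point a \<le> (\<Sum>n. 2 / 3 ^ Suc n)"
    unfolding cantor_point_def
    by (intro suminf_le summable_cantor sums_summable[OF geometric_third_sums])
       (auto simp: of_bool_def)
  then show "cantor_point a \<le> 1"
    using geometric_third_sums by (simp add: sums_iff)
qed

lemma cantor_point_shift:
  "cantor_point a = (2 * of_bool (a 0) + cantor_point (\<lambda>n. a (Suc n))) / 3"
proof -
  have "cantor_point a = (\<Sum>n. 2 * of_bool (a (Suc n)) / 3 ^ Suc (Suc n)) + 2 * of_bool (a 0) / 3"
    using suminf_split_head[OF summable_cantor, of a] by (simp add: cantor_point_def)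
  also have "(\<Sum>n. 2 * of_bool (a (Suc n)) / 3 ^ Suc (Suc n) :: real)
      = cantor_point (\<lambda>n. a (Suc n)) / 3"
    unfolding cantor_point_def
    by (subst suminf_divide[OF summable_cantor, symmetric]) (simp add: mult_ac)
  finally show ?thesis by (simp add: field_simps)
qed

text \<open>Nearby points of the Cantor set share their leading digits: if the first digits differ, they
  contribute \<open>2/3\<close> to the difference and the remaining digits can take back at most \<open>1/3\<close>. After
  stripping a common first digit the difference is multiplied by 3, so induction applies.\<close>

lemma cantor_point_separation:
  assumes "\<bar>cantor_point a - cantor_point b\<bar> < 1 / 3 ^ N" "n < N"
  shows "a n = b n"
  using assms
proof (induction N arbitrary: a b n)
  case (Suc N)
  let ?a = "\<lambda>n. a (Suc n)" and ?b = "\<lambda>n. b (Suc n)"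
  have bd: "0 \<le> cantor_point ?a" "cantor_point ?a \<le> 1" "0 \<le> cantor_point ?b" "cantor_point ?b \<le> 1"
    by (rule cantor_point_bounds)+
  have d: "cantor_point a - cantor_point b =
      (2 * (of_bool (a 0) - of_bool (b 0)) + (cantor_point ?a - cantor_point ?b)) / 3"
    by (subst (1 2) cantor_point_shift) (simp add: field_simps)
  have "1 / 3 ^ Suc N \<le> (1/3 :: real)"
    by (simp add: field_simps)
  with Suc.prems(1) have "\<bar>cantor_point a - cantor_point b\<bar> < 1/3" by linarith
  then have eq0: "a 0 = b 0"
    using bd unfolding d by (cases "a 0"; cases "b 0") auto
  then have "\<bar>cantor_point ?a - cantor_point ?b\<bar> / 3 < 1 / 3 ^ Suc N"
    using Suc.prems(1) unfolding d by (simp add: abs_divide)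
  then have "\<bar>cantor_point ?a - cantor_point ?b\<bar> < 1 / 3 ^ N"
    by (simp add: field_simps)
  from Suc.IH[OF this] show ?case
    using eq0 Suc.prems(2) by (cases n) auto
qed simp

text \<open>The code of a point records, as ternary digits, which members of a countable family of balls
  contain it. The family contains a finite cover by balls of each radius \<open>1 / (k + 1)\<close>, so two points
  whose codes agree on sufficiently many digits lie in a common small ball. Thus the code is only
  Borel, but its inverse is uniformly continuous.\<close>

lemma compact_borel_code:
  assumes "compact (UNIV :: 'a::metric_space set)"
  obtains s :: "'a::metric_space \<Rightarrow> real" where
    "s \<in> borel_measurable borel" "\<And>x. 0 \<le> s x" "\<And>x. s x \<le> 1"
    "\<And>e. e > 0 \<Longrightarrow> \<exists>d>0. \<forall>x y. \<bar>s x - s y\<bar> < d \<longrightarrow> dist x y < e"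
proof -
  have "\<exists>C. finite C \<and> (UNIV :: 'a set) \<subseteq> (\<Union>c\<in>C. ball c (1 / real (Suc k)))" for k
  proof -
    obtain C where "C \<subseteq> (UNIV :: 'a set)" "finite C" "UNIV \<subseteq> (\<Union>c\<in>C. ball c (1 / real (Suc k)))"
      by (rule compactE_image[OF assms, of UNIV "\<lambda>c. ball c (1 / real (Suc k))"]) auto
    then show ?thesis by blast
  qed
  then obtain C where C: "\<And>k. finite (C k)"
      "\<And>k. (UNIV :: 'a set) \<subseteq> (\<Union>c\<in>C k. ball c (1 / real (Suc k)))"
    by metis
  define \<F> where "\<F> = (\<Union>k. (\<lambda>c. ball c (1 / real (Suc k))) ` C k)"
  have "countable \<F>"
    unfolding \<F>_def using C(1)
    by (intro countable_UN[OF countableI_type] countable_image countable_finite)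
  moreover have "\<F> \<noteq> {}"
    using C(2)[of 0] by (fastforce simp: \<F>_def)
  ultimately have A: "range (from_nat_into \<F>) = \<F>"
    by (simp add: range_from_nat_into)
  define A where "A = from_nat_into \<F>"
  note A = A[folded A_def]
  define s where "s x = cantor_point (\<lambda>n. x \<in> A n)" for x
  have openA: "open (A n)" for n
  proof -
    have "A n \<in> \<F>" using A by blast
    then show ?thesis by (auto simp: \<F>_def)
  qed
  show ?thesis
  proof (rule that)
    have [measurable]: "A n \<in> sets borel" for n
      using openA by simp
    show "s \<in> borel_measurable borel"
      unfolding s_def cantor_point_def by measurable
    show "0 \<le> s x" "s x \<le> 1" for x
      by (simp_all add: s_def cantor_point_bounds)
    fix e :: real assume "e > 0"
    then obtain k where k: "1 / real (Suc k) < e / 2"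
      by (metis half_gt_zero nat_approx_posE)
    have "\<exists>n. A n = ball c (1 / real (Suc k))" if "c \<in> C k" for c
    proof -
      have "ball c (1 / real (Suc k)) \<in> range A"
        unfolding A \<F>_def using that by (intro UN_I[of k] imageI) auto
      then show ?thesis by (metis rangeE)
    qed
    then obtain m where m: "\<And>c. c \<in> C k \<Longrightarrow> A (m c) = ball c (1 / real (Suc k))"
      by metis
    \<comment> \<open>Beyond digit \<open>N\<close> all balls of the finite cover of radius \<open>1 / (k + 1)\<close> have been recorded.\<close>
    define N where "N = Suc (Max (m ` C k))"
    have N: "m c < N" if "c \<in> C k" for c
      using that C(1) by (simp add: N_def le_imp_less_Suc)
    have "dist x y < e" if "\<bar>s x - s y\<bar> < 1 / 3 ^ N" for x y
    proof -
      obtain c where c: "c \<in> C k" "x \<in> ball c (1 / real (Suc k))"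
        using C(2)[of k] by blast
      have "x \<in> A (m c) \<longleftrightarrow> y \<in> A (m c)"
        using cantor_point_separation[OF that[unfolded s_def] N[OF c(1)]] .
      then have "y \<in> ball c (1 / real (Suc k))"
        using c m by simp
      then show ?thesis
        using c(2) k dist_triangle3[of x y c] by (auto simp: dist_commute)
    qed
    then show "\<exists>d>0. \<forall>x y. \<bar>s x - s y\<bar> < d \<longrightarrow> dist x y < e"
      by (intro exI[of _ "1 / 3 ^ N"]) auto
  qed
qed

text \<open>The usual extension of a uniformly continuous map to the closure of its domain, for the inverse of
  a code. The modulus \<open>D\<close> of the code serves for all points of the closure at the same time, which
  makes the extension continuous.\<close>

lemma continuous_decoding:
  fixes s :: "'a::metric_space \<Rightarrow> real"
  assumes comp: "compact (UNIV :: 'a set)"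
    and unif: "\<And>e. e > 0 \<Longrightarrow> \<exists>d>0. \<forall>x y. \<bar>s x - s y\<bar> < d \<longrightarrow> dist x y < e"
  obtains p where "continuous_on (closure (range s)) p" "\<And>x. p (s x) = x"
proof -
  obtain D where D: "\<And>e. e > 0 \<Longrightarrow> D e > 0"
      "\<And>e x y. e > 0 \<Longrightarrow> \<bar>s x - s y\<bar> < D e \<Longrightarrow> dist x y < e"
    using unif by metis
  have "\<exists>z. \<forall>e>0. \<forall>y. \<bar>s y - t\<bar> < D e / 2 \<longrightarrow> dist y z < 2 * e" if t: "t \<in> closure (range s)" for t
  proof -
    obtain u where u: "\<And>n. u n \<in> range s" "u \<longlonglongrightarrow> t"
      using t unfolding closure_sequential by auto
    define x where "x n = inv s (u n)" for n
    have x: "s (x n) = u n" for n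
      unfolding x_def by (rule f_inv_into_f[OF u(1)])
    obtain z r where r: "strict_mono r" "(x \<circ> r) \<longlonglongrightarrow> z"
      using seq_compactE[OF comp[unfolded compact_eq_seq_compact_metric], of x] by blast
    have lim: "(\<lambda>n. s (x (r n))) \<longlonglongrightarrow> t"
      using LIMSEQ_subseq_LIMSEQ[OF u(2) r(1)] by (simp add: x o_def)
    have "dist y z < 2 * e" if e: "e > 0" and y: "\<bar>s y - t\<bar> < D e / 2" for e y
    proof -
      have "\<forall>\<^sub>F n in sequentially. dist (s (x (r n))) t < D e / 2"
        using D(1)[OF e] by (intro tendstoD[OF lim]) simp
      moreover have "\<forall>\<^sub>F n in sequentially. dist ((x \<circ> r) n) z < e"
        using r(2) e by (rule tendstoD)
      ultimately have "\<forall>\<^sub>F n in sequentially. dist y z < 2 * e"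
      proof eventually_elim
        case (elim n)
        have "\<bar>s y - s (x (r n))\<bar> < D e"
          using elim(1) y unfolding dist_real_def by linarith
        then have "dist y (x (r n)) < e"
          by (rule D(2)[OF e])
        then show ?case
          using elim(2) dist_triangle[of y z "x (r n)"] by simp
      qed
      then show ?thesis by simp
    qed
    then show ?thesis by blast
  qed
  then obtain p where p: "\<And>t e y. t \<in> closure (range s) \<Longrightarrow> e > 0 \<Longrightarrow> \<bar>s y - t\<bar> < D e / 2
      \<Longrightarrow> dist y (p t) < 2 * e"
    by metis
  show ?thesis
  proof (rule that)
    show "p (s x) = x" for x
    proof (rule ccontr)
      assume "p (s x) \<noteq> x"
      then have pos: "dist x (p (s x)) / 2 > 0" by simp
      have "s x \<in> closure (range s)"
        by (simp add: closure_subset[THEN subsetD])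
      from p[OF this pos, of x] show False
        using D(1)[OF pos] by simp
    qed
    show "continuous_on (closure (range s)) p"
      unfolding continuous_on_iff
    proof (intro ballI allI impI)
      fix t and e :: real assume t: "t \<in> closure (range s)" and "e > 0"
      define h where "h = e / 4"
      have h: "h > 0" using \<open>e > 0\<close> by (simp add: h_def)
      show "\<exists>d>0. \<forall>t'\<in>closure (range s). dist t' t < d \<longrightarrow> dist (p t') (p t) < e"
      proof (intro exI[of _ "D h / 4"] conjI ballI impI)
        show "D h / 4 > 0" using D(1)[OF h] by simp
        fix t' assume t': "t' \<in> closure (range s)" "dist t' t < D h / 4"
        obtain y where y: "dist (s y) t' < D h / 4"
          using t'(1)[unfolded closure_approachable, rule_format, of "D h / 4"] D(1)[OF h] by auto
        have "dist y (p t') < 2 * h"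
          using y D(1)[OF h] unfolding dist_real_def by (intro p t'(1) h) linarith
        moreover have "dist y (p t) < 2 * h"
          using y t'(2) unfolding dist_real_def by (intro p t h) linarith
        ultimately show "dist (p t') (p t) < e"
          using dist_triangle3[of "p t'" "p t" y] by (simp add: h_def)
      qed
    qed
  qed
qed

section \<open>Sequential compactness of the probability measures\<close>

lemma integrable_bcontfun:
  fixes f :: "'a::topological_space \<Rightarrow>\<^sub>C real"
  assumes "\<mu> \<in> prob_measures"
  shows "integrable \<mu> (apply_bcontfun f)"
proof -
  interpret prob_space \<mu> using assms by (simp add: prob_measures_def)
  have [measurable_cong]: "sets \<mu> = sets borel" using assms by (simp add: prob_measures_def)
  have [measurable]: "apply_bcontfun f \<in> borel_measurable borel"
    by (intro borel_measurable_continuous_onI continuous_on_apply_bcontfun)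
  show ?thesis
    by (rule integrable_const_bound[where B = "norm f"]) (use norm_bounded[of f] in auto)
qed

text \<open>Measures are transported to the unit interval by the Borel code, where Helly's selection theorem
  yields a weakly convergent subsequence, and the limit is transported back by the continuous
  decoding \<open>p\<close>, defined on the closure \<open>K\<close> of the set of codes. That \<open>p\<close> is continuous is what matters:
  a continuous \<open>f\<close> becomes the continuous function \<open>f \<circ> p\<close> on \<open>K\<close>, which Tietze extends to the real line,
  so weak convergence on the line gives convergence of \<open>\<integral>f\<close>.\<close>

lemma prob_measures_seq_compact:
  fixes \<mu> :: "nat \<Rightarrow> 'a::metric_space measure"
  assumes comp: "compact (UNIV :: 'a set)" and \<mu>: "\<And>n. \<mu> n \<in> prob_measures"
  obtains r \<nu> where "strict_mono (r :: nat \<Rightarrow> nat)" "\<nu> \<in> prob_measures"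
    "\<And>f :: 'a \<Rightarrow>\<^sub>C real. (\<lambda>n. \<integral>y. apply_bcontfun f y \<partial>\<mu> (r n)) \<longlonglongrightarrow> (\<integral>y. apply_bcontfun f y \<partial>\<nu>)"
proof -
  obtain s :: "'a \<Rightarrow> real" where s[measurable]: "s \<in> borel_measurable borel"
    and s01: "\<And>x. 0 \<le> s x" "\<And>x. s x \<le> 1"
    and unif: "\<And>e. e > 0 \<Longrightarrow> \<exists>d>0. \<forall>x y. \<bar>s x - s y\<bar> < d \<longrightarrow> dist x y < e"
    using compact_borel_code[OF comp] by metis
  define K where "K = closure (range s)"
  obtain p where p: "continuous_on K p" "\<And>x. p (s x) = x"
    unfolding K_def using continuous_decoding[OF comp unif] by metis
  have sK: "s x \<in> K" for x
    by (simp add: K_def closure_subset[THEN subsetD])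
  have [simp]: "closed K" by (simp add: K_def)
  have K_borel[measurable]: "K \<in> sets borel" by simp
  have sets_\<mu>[measurable_cong]: "sets (\<mu> n) = sets borel" for n
    using \<mu> by (simp add: prob_measures_def)
  have prob_\<mu>: "prob_space (\<mu> n)" for n
    using \<mu> by (simp add: prob_measures_def)
  define m where "m n = distr (\<mu> n) borel s" for n
  have m_real: "real_distribution (m n)" for n
    unfolding real_distribution_def real_distribution_axioms_def m_def
    using prob_\<mu> by (auto intro: prob_space.prob_space_distr)
  have "tight m"
    unfolding tight_def
  proof (intro conjI allI impI)
    fix e :: real assume "e > 0"
    have "measure (m n) {-1<..1} = 1" for n
    proof -
      interpret prob_space "\<mu> n" by (rule prob_\<mu>)
      have "s -` {-1<..1} = UNIV"
      proof (intro set_eqI iffI)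
        show "x \<in> s -` {-1<..1}" for x
          using s01[of x] by simp
      qed simp
      then show ?thesis
        using prob_space sets_eq_imp_space_eq[OF sets_\<mu>[of n]] by (simp add: m_def measure_distr)
    qed
    then show "\<exists>a b. a < b \<and> (\<forall>n. 1 - e < measure (m n) {a<..b})"
      using \<open>e > 0\<close> by (intro exI[of _ "-1"] exI[of _ 1]) auto
  qed (rule m_real)
  then obtain r M where r: "strict_mono r" and M: "real_distribution M"
    and conv: "weak_conv_m (m \<circ> id \<circ> r) M"
    using tight_imp_convergent_subsubsequence[OF _ strict_mono_id] by blast
  interpret M: real_distribution M by (rule M)
  have lim: "(\<lambda>n. \<integral>t. g t \<partial>m (r n)) \<longlonglongrightarrow> (\<integral>t. g t \<partial>M)"
    if "continuous_on UNIV g" "\<And>t. norm (g t) \<le> B" for g :: "real \<Rightarrow> real" and B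
    by (rule weak_conv_imp_integral_bdd_continuous_conv[OF m_real M, of "\<lambda>n. r n"])
       (use that conv in \<open>auto simp: continuous_on_eq_continuous_at o_def\<close>)
  have int_m: "(\<integral>t. g t \<partial>m n) = (\<integral>x. g (s x) \<partial>\<mu> n)" if "g \<in> borel_measurable borel"
    for g :: "real \<Rightarrow> real" and n
    unfolding m_def using that by (intro integral_distr) auto
  \<comment> \<open>The limit measure does not charge the complement of \<open>K\<close>: test with the distance to \<open>K\<close>.\<close>
  have AE_K: "AE t in M. t \<in> K"
  proof -
    define g where "g t = min 1 (infdist t K)" for t :: real
    have g: "continuous_on UNIV g" "norm (g t) \<le> 1" for t
      by (auto simp: g_def infdist_nonneg intro!: continuous_intros)
    have gm[measurable]: "g \<in> borel_measurable borel"
      using g(1) by (rule borel_measurable_continuous_onI)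
    have "g (s x) = 0" for x
      using sK by (simp add: g_def)
    then have "(\<lambda>n. \<integral>t. g t \<partial>m (r n)) \<longlonglongrightarrow> 0"
      by (simp add: int_m[OF gm])
    then have "(\<integral>t. g t \<partial>M) = 0"
      using lim[OF g] LIMSEQ_unique by blast
    moreover have "integrable M g"
      by (rule M.integrable_const_bound[where B = 1]) (use g(2) in auto)
    ultimately have "AE t in M. g t = 0"
      by (subst (asm) integral_nonneg_eq_0_iff_AE) (auto simp: g_def infdist_nonneg)
    moreover have "t \<in> K" if "g t = 0" for t
      using that in_closed_iff_infdist_zero[of K t] sK
      by (auto simp: g_def min_def split: if_splits)
    ultimately show ?thesis by auto
  qed
  \<comment> \<open>The value off \<open>K\<close> is arbitrary, since the limit measure lives on \<open>K\<close>.\<close>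
  define q where "q t = (if t \<in> K then p t else p (s undefined))" for t
  have q[measurable]: "q \<in> borel_measurable borel"
  proof -
    have "p \<in> borel_measurable (restrict_space borel K)"
      by (rule borel_measurable_continuous_on_restrict[OF p(1)])
    then show ?thesis
      unfolding q_def by (intro measurable_If_restrict_space_iff[THEN iffD2]) auto
  qed
  define \<nu> where "\<nu> = distr M borel q"
  have "(\<lambda>n. \<integral>y. apply_bcontfun f y \<partial>\<mu> (r n)) \<longlonglongrightarrow> (\<integral>y. apply_bcontfun f y \<partial>\<nu>)"
    for f :: "'a \<Rightarrow>\<^sub>C real"
  proof -
    have fm[measurable]: "apply_bcontfun f \<in> borel_measurable borel"
      by (intro borel_measurable_continuous_onI continuous_on_apply_bcontfun)
    have "continuous_on K (\<lambda>t. apply_bcontfun f (p t))"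
      by (rule continuous_on_compose2[OF continuous_on_apply_bcontfun p(1)]) auto
    then obtain g where g: "continuous_on UNIV g" "\<And>t. t \<in> K \<Longrightarrow> g t = apply_bcontfun f (p t)"
      "\<And>t. norm (g t) \<le> norm f"
      by (rule Tietze[of K _ UNIV "norm f"]) (use norm_bounded[of f] in auto)
    have gm[measurable]: "g \<in> borel_measurable borel"
      using g(1) by (rule borel_measurable_continuous_onI)
    have "(\<integral>y. apply_bcontfun f y \<partial>\<nu>) = (\<integral>t. apply_bcontfun f (q t) \<partial>M)"
      unfolding \<nu>_def by (rule integral_distr) auto
    also have "\<dots> = (\<integral>t. g t \<partial>M)"
    proof (rule integral_cong_AE)
      show "AE t in M. apply_bcontfun f (q t) = g t"
        using AE_K by eventually_elim (simp add: q_def g(2))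
    qed measurable
    finally show ?thesis
      using lim[OF g(1,3)] by (simp add: int_m[OF gm] g(2)[OF sK] p(2))
  qed
  moreover have "\<nu> \<in> prob_measures"
    unfolding prob_measures_def \<nu>_def by (auto intro: M.prob_space_distr)
  ultimately show ?thesis using that r by blast
qed

section \<open>The weak* topology of a compact metric space\<close>

lemma topspace_weak_star: "topspace weak_star = (prob_measures :: 'a::topological_space measure set)"
  unfolding weak_star_def topology_generated_by_topspace
proof (intro equalityI subsetI)
  fix \<mu> :: "'a measure" assume "\<mu> \<in> prob_measures"
  then show "\<mu> \<in> \<Union>{{\<mu> \<in> prob_measures. (\<integral>y. apply_bcontfun f y \<partial>\<mu>) \<in> U} |
      (f :: 'a \<Rightarrow>\<^sub>C real) U. open U}"
    by (intro UnionI[of prob_measures] CollectI exI[of _ 0] exI[of _ UNIV]) auto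
qed auto

lemma openin_weak_star_integral:
  fixes f :: "'a::topological_space \<Rightarrow>\<^sub>C real"
  assumes "open U"
  shows "openin weak_star {\<mu> \<in> prob_measures. (\<integral>y. apply_bcontfun f y \<partial>\<mu>) \<in> U}"
  unfolding weak_star_def using assms
  by (intro topology_generated_by_Basis CollectI exI[of _ f] exI[of _ U]) simp

text \<open>The condition on integrals says that the net is eventually in each subbasic neighbourhood of \<open>\<nu>\<close>;
  this passes to finite intersections and unions.\<close>

lemma limitin_weak_star:
  fixes \<nu> :: "'a::topological_space measure"
  assumes "\<nu> \<in> prob_measures" "\<And>n. \<mu> n \<in> prob_measures"
    and lim: "\<And>f :: 'a \<Rightarrow>\<^sub>C real. ((\<lambda>n. \<integral>y. apply_bcontfun f y \<partial>\<mu> n) \<longlongrightarrow> (\<integral>y. apply_bcontfun f y \<partial>\<nu>)) net"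
  shows "limitin weak_star \<mu> \<nu> net"
  unfolding limitin_def
proof (intro conjI allI impI)
  show "\<nu> \<in> topspace weak_star"
    by (simp add: topspace_weak_star assms)
  fix W assume W: "openin weak_star W \<and> \<nu> \<in> W"
  then have "generate_topology_on {{\<mu> \<in> prob_measures. (\<integral>y. apply_bcontfun f y \<partial>\<mu>) \<in> U} |
      (f :: 'a \<Rightarrow>\<^sub>C real) U. open U} W"
    unfolding weak_star_def by (simp add: openin_topology_generated_by)
  then have "\<nu> \<in> W \<longrightarrow> (\<forall>\<^sub>F n in net. \<mu> n \<in> W)"
  proof (induction rule: generate_topology_on.induct)
    case (UN K)
    show ?case
    proof
      assume "\<nu> \<in> \<Union>K"
      then obtain k where k: "k \<in> K" "\<nu> \<in> k" by blast
      with UN.IH[OF k(1)] have "\<forall>\<^sub>F n in net. \<mu> n \<in> k" by simp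
      then show "\<forall>\<^sub>F n in net. \<mu> n \<in> \<Union>K"
        by (rule eventually_mono) (use k in blast)
    qed
  next
    case (Basis s)
    then obtain f :: "'a \<Rightarrow>\<^sub>C real" and U where s: "s = {\<mu> \<in> prob_measures. (\<integral>y. apply_bcontfun f y \<partial>\<mu>) \<in> U}" "open U"
      by auto
    show ?case
      using topological_tendstoD[OF lim[of f] s(2)] assms(2) by (simp add: s(1))
  qed (auto intro: eventually_conj)
  then show "\<forall>\<^sub>F n in net. \<mu> n \<in> W"
    using W by simp
qed

lemma compact_weak_star:
  assumes "compact (UNIV :: 'a::metric_space set)" "metrizing_family (F :: nat \<Rightarrow> 'a \<Rightarrow>\<^sub>C real)"
  shows "compact_space (weak_star :: 'a measure topology)"
proof -
  interpret Metric_space "prob_measures :: 'a measure set" "rho F"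
    using assms(2) by (simp add: metrizing_family_def)
  have mt: "mtopology = weak_star"
    using assms(2) by (simp add: metrizing_family_def)
  have "\<exists>\<nu> r. \<nu> \<in> prob_measures \<and> strict_mono r \<and> limitin mtopology (\<sigma> \<circ> r) \<nu> sequentially"
    if \<sigma>: "range \<sigma> \<subseteq> prob_measures" for \<sigma> :: "nat \<Rightarrow> 'a measure"
  proof -
    have \<sigma>n: "\<sigma> n \<in> prob_measures" for n using \<sigma> by auto
    obtain r \<nu> where "strict_mono r" "\<nu> \<in> prob_measures"
      "\<And>f :: 'a \<Rightarrow>\<^sub>C real. (\<lambda>n. \<integral>y. apply_bcontfun f y \<partial>\<sigma> (r n)) \<longlonglongrightarrow> (\<integral>y. apply_bcontfun f y \<partial>\<nu>)"
      using prob_measures_seq_compact[OF assms(1), of \<sigma>] \<sigma>n by metis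
    then have "limitin mtopology (\<sigma> \<circ> r) \<nu> sequentially"
      unfolding mt using \<sigma>n by (intro limitin_weak_star) auto
    then show ?thesis
      using \<open>strict_mono r\<close> \<open>\<nu> \<in> prob_measures\<close> by blast
  qed
  then have "compact_space mtopology"
    unfolding compact_space_sequentially by blast
  then show ?thesis by (simp add: mt)
qed

text \<open>Balls of radius \<open>1 / (n + 1)\<close> around the points of a finite net for that radius form a countable base.\<close>

lemma (in Metric_space) compact_imp_second_countable:
  assumes "compact_space mtopology"
  shows "second_countable mtopology"
proof -
  have "mtotally_bounded M"
    using assms compactin_imp_mtotally_bounded[of M] by (simp add: compact_space_def)
  then have "\<exists>K. finite K \<and> K \<subseteq> M \<and> M \<subseteq> (\<Union>x\<in>K. mball x (1 / real (Suc n)))" for n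
    unfolding mtotally_bounded_def by simp
  then obtain K where K: "\<And>n. finite (K n)" "\<And>n. K n \<subseteq> M"
      "\<And>n. M \<subseteq> (\<Union>x\<in>K n. mball x (1 / real (Suc n)))"
    by metis
  define \<B> where "\<B> = (\<Union>n. (\<lambda>x. mball x (1 / real (Suc n))) ` K n)"
  have "countable \<B>"
    unfolding \<B>_def using K(1)
    by (intro countable_UN[OF countableI_type] countable_image countable_finite)
  moreover have "\<forall>V\<in>\<B>. openin mtopology V"
    by (auto simp: \<B>_def)
  moreover have "\<exists>V\<in>\<B>. x \<in> V \<and> V \<subseteq> U" if U: "openin mtopology U" "x \<in> U" for U x
  proof -
    obtain e where e: "e > 0" "mball x e \<subseteq> U" and x: "x \<in> M"
      using U unfolding openin_mtopology by blast
    obtain n where n: "1 / real (Suc n) < e / 2"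
      using e(1) by (metis half_gt_zero nat_approx_posE)
    obtain c where c: "c \<in> K n" "x \<in> mball c (1 / real (Suc n))"
      using K(3)[of n] x by blast
    have "mball c (1 / real (Suc n)) \<subseteq> mball x e"
    proof
      fix y assume "y \<in> mball c (1 / real (Suc n))"
      then show "y \<in> mball x e"
        using c(2) n triangle[of x c y] by (auto simp: in_mball commute[of x c])
    qed
    then show ?thesis
      using e(2) c by (intro bexI[of _ "mball c (1 / real (Suc n))"]) (auto simp: \<B>_def)
  qed
  ultimately show ?thesis
    unfolding second_countable_def by (intro exI[of _ \<B>] conjI allI impI) auto
qed

lemma second_countable_weak_star:
  assumes "compact (UNIV :: 'a::metric_space set)" "metrizing_family (F :: nat \<Rightarrow> 'a \<Rightarrow>\<^sub>C real)"
  shows "second_countable (weak_star :: 'a measure topology)"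
proof -
  interpret Metric_space "prob_measures :: 'a measure set" "rho F"
    using assms(2) by (simp add: metrizing_family_def)
  have "mtopology = weak_star"
    using assms(2) by (simp add: metrizing_family_def)
  then show ?thesis
    using compact_imp_second_countable compact_weak_star[OF assms] by simp
qed

section \<open>Empirical measures\<close>

lemma empirical_prob:
  assumes "n > 0"
  shows "empirical T x n \<in> prob_measures"
proof -
  have "prob_space (uniform_count_measure {..<n})"
    using assms by (intro prob_space_uniform_count_measure) auto
  moreover have "(\<lambda>i. (T ^^ i) x) \<in> measurable (uniform_count_measure {..<n}) borel"
    by (simp add: measurable_def sets_uniform_count_measure space_uniform_count_measure)
  ultimately show ?thesis
    unfolding prob_measures_def empirical_def by (simp add: prob_space.prob_space_distr)
qed

lemma integral_empirical_bcontfun: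
  fixes f :: "'a::topological_space \<Rightarrow>\<^sub>C real"
  shows "(\<integral>y. apply_bcontfun f y \<partial>empirical T x n) = (\<Sum>i<n. apply_bcontfun f ((T ^^ i) x)) / real n"
  by (intro integral_empirical borel_measurable_continuous_onI continuous_on_apply_bcontfun)

lemma continuous_on_funpow:
  "continuous_on UNIV T \<Longrightarrow> continuous_on UNIV (T ^^ i)"
  for T :: "'a::topological_space \<Rightarrow> 'a"
proof (induction i)
  case (Suc i)
  then show ?case
    using continuous_on_compose2[of UNIV T UNIV "T ^^ i"] by (simp add: o_def)
qed (simp add: id_def continuous_on_id)

lemma open_empirical_preimage:
  fixes T :: "'a::topological_space \<Rightarrow> 'a"
  assumes T: "continuous_on UNIV T" and "n > 0" and W: "openin weak_star W"
  shows "open {x. empirical T x n \<in> W}"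
proof -
  have cont: "continuous_on UNIV (\<lambda>x. \<integral>y. apply_bcontfun f y \<partial>empirical T x n)" for f :: "'a \<Rightarrow>\<^sub>C real"
    unfolding integral_empirical_bcontfun
    by (intro continuous_intros continuous_on_compose2[OF continuous_on_apply_bcontfun continuous_on_funpow[OF T]])
       (use \<open>n > 0\<close> in auto)
  have "continuous_map euclidean weak_star (\<lambda>x. empirical T x n)"
    unfolding weak_star_def
  proof (rule continuous_on_generated_topo)
    fix U assume "U \<in> {{\<mu> \<in> prob_measures. (\<integral>y. apply_bcontfun f y \<partial>\<mu>) \<in> U} | (f :: 'a \<Rightarrow>\<^sub>C real) U. open U}"
    then obtain f :: "'a \<Rightarrow>\<^sub>C real" and Q where
      U: "U = {\<mu> \<in> prob_measures. (\<integral>y. apply_bcontfun f y \<partial>\<mu>) \<in> Q}" "open Q" by blast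
    have "(\<lambda>x. empirical T x n) -` U = (\<lambda>x. \<integral>y. apply_bcontfun f y \<partial>empirical T x n) -` Q"
      using empirical_prob[OF \<open>n > 0\<close>] by (auto simp: U)
    then show "openin euclidean ((\<lambda>x. empirical T x n) -` U \<inter> topspace euclidean)"
      using open_vimage[OF U(2) cont] by simp
  next
    show "(\<lambda>x. empirical T x n) ` topspace euclidean
        \<subseteq> \<Union>{{\<mu> \<in> prob_measures. (\<integral>y. apply_bcontfun f y \<partial>\<mu>) \<in> U} | (f :: 'a \<Rightarrow>\<^sub>C real) U. open U}"
      using empirical_prob[OF \<open>n > 0\<close>, of T] topspace_weak_star[where 'a = 'a]
      unfolding weak_star_def topology_generated_by_topspace by blast
  qed
  from openin_continuous_map_preimage[OF this W] show ?thesis by simp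
qed

section \<open>Accumulation points of empirical measures\<close>

locale compact_system =
  fixes T :: "'a::metric_space \<Rightarrow> 'a" and F :: "nat \<Rightarrow> ('a \<Rightarrow>\<^sub>C real)"
  assumes compact_UNIV: "compact (UNIV :: 'a set)"
    and continuous_T: "continuous_on UNIV T"
    and metrizing: "metrizing_family F"
begin

sublocale P: Metric_space "prob_measures :: 'a measure set" "rho F"
  using metrizing by (simp add: metrizing_family_def)

lemma mtopology_weak_star: "P.mtopology = weak_star"
  using metrizing by (simp add: metrizing_family_def)

lemma openin_mball_weak_star: "openin weak_star (P.mball \<mu> e)"
  using P.openin_mball[of \<mu> e] by (simp add: mtopology_weak_star)

lemma compactin_weak_star_closed:
  "closedin weak_star (C :: 'a measure set) \<Longrightarrow> compactin weak_star C"
  by (rule closedin_compact_space[OF compact_weak_star[OF compact_UNIV metrizing]])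

lemma V_subset_prob_measures: "V T x \<subseteq> prob_measures"
  by (auto simp: V_def)

lemma V_frequently: "\<nu> \<in> V T x \<Longrightarrow> openin weak_star W \<Longrightarrow> \<nu> \<in> W \<Longrightarrow>
    \<exists>\<^sub>F n in sequentially. empirical T x n \<in> W"
  by (simp add: V_def)

text \<open>The accumulation principle: if every point of \<open>C\<close> had a neighbourhood that the empirical measures
  eventually avoid, then finitely many of these neighbourhoods would cover \<open>C\<close>, and their union would
  be a neighbourhood of \<open>C\<close> that is eventually avoided.\<close>

lemma V_meets_compact:
  assumes C: "compactin weak_star C"
    and freq: "\<And>W. openin weak_star W \<Longrightarrow> C \<subseteq> W \<Longrightarrow> \<exists>\<^sub>F n in sequentially. empirical T x n \<in> W"
  shows "V T x \<inter> C \<noteq> {}"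
proof
  assume empty: "V T x \<inter> C = {}"
  define \<U> where "\<U> = {W. openin weak_star W \<and> \<not> (\<exists>\<^sub>F n in sequentially. empirical T x n \<in> W)}"
  have "C \<subseteq> prob_measures"
    using compactin_subset_topspace[OF C] by (simp add: topspace_weak_star)
  have "C \<subseteq> \<Union>\<U>"
  proof
    fix \<nu> assume "\<nu> \<in> C"
    with empty \<open>C \<subseteq> prob_measures\<close> have "\<nu> \<in> prob_measures" "\<nu> \<notin> V T x" by auto
    then show "\<nu> \<in> \<Union>\<U>" by (auto simp: V_def \<U>_def)
  qed
  then obtain \<F> where \<F>: "finite \<F>" "\<F> \<subseteq> \<U>" "C \<subseteq> \<Union>\<F>"
    using compactinD[OF C, of \<U>] by (auto simp: \<U>_def)
  have "openin weak_star (\<Union>\<F>)"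
    using \<F>(2) by (intro openin_Union) (auto simp: \<U>_def)
  then have "\<exists>\<^sub>F n in sequentially. empirical T x n \<in> \<Union>\<F>"
    using freq \<F>(3) by blast
  moreover have "\<forall>\<^sub>F n in sequentially. \<forall>W\<in>\<F>. empirical T x n \<notin> W"
    using \<F>(1,2) by (intro eventually_ball_finite) (auto simp: \<U>_def not_frequently)
  ultimately show False
    by (auto simp: frequently_def elim: eventually_mono)
qed

lemma V_nonempty: "V T x \<noteq> {}"
proof -
  have "compactin weak_star (prob_measures :: 'a measure set)"
    using compact_weak_star[OF compact_UNIV metrizing]
    by (simp add: compact_space_def topspace_weak_star)
  then have "V T x \<inter> prob_measures \<noteq> {}"
  proof (rule V_meets_compact)
    fix W :: "'a measure set" assume "prob_measures \<subseteq> W"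
    then have "\<forall>\<^sub>F n in sequentially. empirical T x n \<in> W"
      using empirical_prob[of _ T x] by (intro eventually_sequentiallyI[of 1]) auto
    then show "\<exists>\<^sub>F n in sequentially. empirical T x n \<in> W"
      by (simp add: eventually_frequently)
  qed
  then show ?thesis by blast
qed

text \<open>The infimum behaves as expected only because \<open>V T x\<close> is nonempty, since the infimum of an
  empty set of reals has no determined value.\<close>

lemma G_set_iff:
  assumes "\<mu> \<in> prob_measures"
  shows "x \<in> G_set F T \<mu> e \<longleftrightarrow> (\<forall>e'>e. \<exists>\<nu>\<in>V T x. rho F \<mu> \<nu> < e')"
proof -
  have "bdd_below (rho F \<mu> ` V T x)"
    by (intro bdd_belowI[of _ 0]) (auto intro: P.nonneg)
  from cINF_less_iff[OF V_nonempty this]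
  have "(\<forall>e'>e. \<exists>\<nu>\<in>V T x. rho F \<mu> \<nu> < e') \<longleftrightarrow> (\<forall>e'>e. (INF \<nu>\<in>V T x. rho F \<mu> \<nu>) < e')"
    by simp
  also have "\<dots> \<longleftrightarrow> (INF \<nu>\<in>V T x. rho F \<mu> \<nu>) \<le> e"
    by (auto intro: dense_ge less_imp_le)
  finally show ?thesis by (simp add: G_set_def)
qed

text \<open>Membership in \<open>G_set\<close> is rewritten through empirical measures instead of their accumulation points,
  so that it becomes a countable condition on open sets. In the direction from right to left, infinitely
  many visits to a ball produce an accumulation point in the closed ball of the same radius.\<close>

lemma G_set_eq_Inter:
  assumes \<mu>: "\<mu> \<in> prob_measures"
  shows "G_set F T \<mu> e =
    (\<Inter>k. {x. \<exists>\<^sub>F n in sequentially. empirical T x n \<in> P.mball \<mu> (e + 1 / real (Suc k))})"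
proof (intro set_eqI iffI)
  fix x assume x: "x \<in> G_set F T \<mu> e"
  have "\<exists>\<^sub>F n in sequentially. empirical T x n \<in> P.mball \<mu> (e + 1 / real (Suc k))" for k
  proof -
    obtain \<nu> where \<nu>: "\<nu> \<in> V T x" "rho F \<mu> \<nu> < e + 1 / real (Suc k)"
      using x unfolding G_set_iff[OF \<mu>] by (auto dest: spec[of _ "e + 1 / real (Suc k)"])
    show ?thesis
      using V_frequently[OF \<nu>(1) openin_mball_weak_star] \<nu> \<mu> V_subset_prob_measures[of x]
      by (auto simp: P.in_mball)
  qed
  then show "x \<in> (\<Inter>k. {x. \<exists>\<^sub>F n in sequentially. empirical T x n \<in> P.mball \<mu> (e + 1 / real (Suc k))})"
    by simp
next
  fix x assume x: "x \<in> (\<Inter>k. {x. \<exists>\<^sub>F n in sequentially. empirical T x n \<in> P.mball \<mu> (e + 1 / real (Suc k))})"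
  have "\<exists>\<nu>\<in>V T x. rho F \<mu> \<nu> < e'" if e': "e' > e" for e'
  proof -
    obtain k where k: "1 / real (Suc k) < e' - e"
      using e' nat_approx_posE[of "e' - e"] by auto
    define C where "C = P.mcball \<mu> (e + 1 / real (Suc k))"
    have "closedin weak_star C"
      unfolding C_def using P.closedin_mcball by (simp add: mtopology_weak_star)
    then have "V T x \<inter> C \<noteq> {}"
    proof (intro V_meets_compact compactin_weak_star_closed)
      fix W assume "C \<subseteq> W"
      have "\<exists>\<^sub>F n in sequentially. empirical T x n \<in> P.mball \<mu> (e + 1 / real (Suc k))"
        using x by blast
      then show "\<exists>\<^sub>F n in sequentially. empirical T x n \<in> W"
        by (rule frequently_elim1) (use \<open>C \<subseteq> W\<close> P.mball_subset_mcball in \<open>auto simp: C_def\<close>)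
    qed
    then show ?thesis
      using k by (force simp: C_def P.in_mcball)
  qed
  then show "x \<in> G_set F T \<mu> e"
    by (simp add: G_set_iff[OF \<mu>])
qed

lemma visits_eq_Inter:
  "{x. \<exists>\<^sub>F n in sequentially. empirical T x n \<in> W}
    = (\<Inter>N. \<Union>n\<in>{Suc N..}. {x. empirical T x n \<in> W})" (is "?L = ?R")
proof (intro set_eqI iffI)
  fix x assume "x \<in> ?L"
  then have "\<exists>n\<ge>Suc N. empirical T x n \<in> W" for N
    by (simp add: frequently_sequentially)
  then show "x \<in> ?R" by auto
next
  fix x assume "x \<in> ?R"
  then have "\<exists>n\<ge>N. empirical T x n \<in> W" for N
    by (auto dest!: INT_D[of _ _ _ N] Suc_leD)
  then show "x \<in> ?L"
    by (simp add: frequently_sequentially)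
qed

text \<open>This set, and not the set of points with infinitely many visits, is open; the latter is the
  countable intersection over \<open>N\<close>. Starting at \<open>Suc N\<close> avoids the zero measure at time 0.\<close>

lemma open_visits_after:
  assumes "openin weak_star W"
  shows "open (\<Union>n\<in>{Suc N..}. {x. empirical T x n \<in> W})"
  using assms by (intro open_UN ballI open_empirical_preimage continuous_T) auto

lemma G_set_borel:
  assumes "\<mu> \<in> prob_measures"
  shows "G_set F T \<mu> e \<in> sets borel"
  unfolding G_set_eq_Inter[OF assms] visits_eq_Inter
  by (intro sets.countable_INT'' borel_open open_visits_after openin_mball_weak_star) auto

text \<open>Baire's theorem for the sets of points whose empirical measures visit \<open>W\<close> after time \<open>N\<close>. Density
  is supplied by the points \<open>x\<close> with \<open>V T x\<close> meeting \<open>W\<close>, since these return to the open set \<open>W\<close> infinitely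
  often. The accumulation points themselves need only lie in the closure of \<open>W\<close>.\<close>

lemma residual_visits:
  assumes "countable \<W>" and op: "\<And>W. W \<in> \<W> \<Longrightarrow> openin weak_star W"
    and dense: "\<And>W. W \<in> \<W> \<Longrightarrow> closure {x. V T x \<inter> W \<noteq> {}} = UNIV"
  shows "residual {x. \<forall>W\<in>\<W>. \<exists>\<^sub>F n in sequentially. empirical T x n \<in> W}"
proof -
  define H where "H = (\<lambda>(W, N). \<Union>n\<in>{Suc N..}. {x. empirical T x n \<in> W})"
  \<comment> \<open>With \<open>UNIV\<close> included, the family can be enumerated even if \<open>\<W>\<close> is empty.\<close>
  define \<G> where "\<G> = insert UNIV (H ` (\<W> \<times> UNIV))"
  have cG: "countable \<G>"
    unfolding \<G>_def using assms(1) by auto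
  have G: "open S \<and> closure S = UNIV" if S: "S \<in> \<G>" for S
  proof (cases "S = UNIV")
    case False
    then obtain W N where W: "W \<in> \<W>" and S: "S = (\<Union>n\<in>{Suc N..}. {x. empirical T x n \<in> W})"
      using S by (auto simp: \<G>_def H_def)
    have "{x. V T x \<inter> W \<noteq> {}} \<subseteq> {x. \<exists>\<^sub>F n in sequentially. empirical T x n \<in> W}"
      using V_frequently[OF _ op[OF W]] by auto
    also have "\<dots> \<subseteq> S"
      unfolding visits_eq_Inter S by blast
    finally have "closure S = UNIV"
      using dense[OF W] closure_mono by blast
    moreover have "open S"
      unfolding S by (rule open_visits_after[OF op[OF W]])
    ultimately show ?thesis by simp
  qed simp
  have "compact_space (euclidean :: 'a topology)"
    using compact_UNIV by (simp add: compact_space_def compactin_euclidean_iff)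
  then have "closure (\<Inter>\<G>) = UNIV"
    using Baire_category[of "euclidean :: 'a topology" \<G>] G cG
    by (auto simp: compact_imp_locally_compact_space regular_space_euclidean)
  moreover have "gdelta (\<Inter>\<G>)"
  proof -
    have range: "range (from_nat_into \<G>) = \<G>"
      using cG by (intro range_from_nat_into) (auto simp: \<G>_def)
    have "open (from_nat_into \<G> n)" for n
      using G[of "from_nat_into \<G> n"] rangeI[of "from_nat_into \<G>" n] by (simp add: range)
    then have "gdelta (\<Inter>(range (from_nat_into \<G>)))"
      by (rule gdelta.intros)
    then show ?thesis by (simp add: range)
  qed
  moreover have "\<Inter>\<G> \<subseteq> {x. \<forall>W\<in>\<W>. \<exists>\<^sub>F n in sequentially. empirical T x n \<in> W}"
  proof
    fix x assume x: "x \<in> \<Inter>\<G>"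
    have "x \<in> {x. \<exists>\<^sub>F n in sequentially. empirical T x n \<in> W}" if "W \<in> \<W>" for W
      unfolding visits_eq_Inter
    proof
      fix N
      have "H (W, N) \<in> \<G>" using that by (simp add: \<G>_def)
      then show "x \<in> (\<Union>n\<in>{Suc N..}. {x. empirical T x n \<in> W})"
        using x by (auto simp: H_def)
    qed
    then show "x \<in> {x. \<forall>W\<in>\<W>. \<exists>\<^sub>F n in sequentially. empirical T x n \<in> W}"
      by simp
  qed
  ultimately show ?thesis unfolding residual_def by blast
qed

text \<open>The two orbit segments of length \<open>n\<close> share all but one point each, and the test functions have norm 1.\<close>

lemma rho_empirical_shift:
  assumes "n > 0"
  shows "rho F (empirical T x n) (empirical T (T x) n) \<le> 2 / real n"
proof -
  define a where "a i = \<bar>(\<integral>y. apply_bcontfun (F i) y \<partial>empirical T x n)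
      - (\<integral>y. apply_bcontfun (F i) y \<partial>empirical T (T x) n)\<bar> / 2 ^ Suc i" for i
  have bound: "a i \<le> 2 / real n * (1/2) ^ Suc i" for i
  proof -
    let ?f = "apply_bcontfun (F i)"
    have f: "\<bar>?f y\<bar> \<le> 1" for y
      using norm_bounded[of "F i" y] metrizing by (simp add: metrizing_family_def)
    \<comment> \<open>Telescoping: both sides sum \<open>?f\<close> over the first \<open>n + 1\<close> points of the orbit of \<open>x\<close>.\<close>
    have "(\<Sum>j<n. ?f ((T ^^ j) (T x))) + ?f x = (\<Sum>j<Suc n. ?f ((T ^^ j) x))"
      by (subst sum.lessThan_Suc_shift) (simp add: funpow_swap1)
    then have "(\<Sum>j<n. ?f ((T ^^ j) x)) - (\<Sum>j<n. ?f ((T ^^ j) (T x))) = ?f x - ?f ((T ^^ n) x)"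
      by simp
    then have "\<bar>(\<Sum>j<n. ?f ((T ^^ j) x)) / real n - (\<Sum>j<n. ?f ((T ^^ j) (T x))) / real n\<bar>
        = \<bar>?f x - ?f ((T ^^ n) x)\<bar> / real n"
      by (simp add: diff_divide_distrib[symmetric])
    also have "\<dots> \<le> 2 / real n"
      using f[of x] f[of "(T ^^ n) x"] by (intro divide_right_mono) auto
    finally show ?thesis
      unfolding a_def integral_empirical_bcontfun by (simp add: power_one_over field_simps)
  qed
  have sums: "(\<lambda>i. 2 / real n * (1/2) ^ Suc i) sums (2 / real n)"
    using sums_mult[OF power_half_series, of "2 / real n"] by simp
  have "summable a"
    by (rule summable_comparison_test[OF _ sums_summable[OF sums]])
       (use bound in \<open>auto simp: a_def\<close>)
  then have "suminf a \<le> 2 / real n"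
    using suminf_le[OF bound _ sums_summable[OF sums]] sums by (simp add: sums_iff)
  then show ?thesis
    using empirical_prob[OF assms] by (simp add: rho_def a_def[abs_def])
qed

text \<open>A visit of one orbit to the ball of half the radius around \<open>\<mu>\<close> forces, at the same late time, a visit of
  the other orbit to the full ball.\<close>

lemma V_subset_of_asymptotic:
  assumes "\<And>e. e > 0 \<Longrightarrow> \<forall>\<^sub>F n in sequentially. rho F (empirical T x n) (empirical T y n) < e"
  shows "V T x \<subseteq> V T y"
proof
  fix \<mu> assume \<mu>: "\<mu> \<in> V T x"
  then have \<mu>P: "\<mu> \<in> prob_measures" using V_subset_prob_measures by blast
  have "\<exists>\<^sub>F n in sequentially. empirical T y n \<in> W" if W: "openin weak_star W" "\<mu> \<in> W" for W
  proof -
    obtain e where e: "e > 0" "P.mball \<mu> e \<subseteq> W"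
      using W unfolding mtopology_weak_star[symmetric] P.openin_mtopology by blast
    have "\<exists>\<^sub>F n in sequentially. empirical T x n \<in> P.mball \<mu> (e / 2)"
      using e(1) \<mu>P by (intro V_frequently[OF \<mu> openin_mball_weak_star]) simp
    moreover have "\<forall>\<^sub>F n in sequentially. rho F (empirical T x n) (empirical T y n) < e / 2
        \<and> n > 0"
      using assms[of "e / 2"] e(1) by (intro eventually_conj eventually_gt_at_top) simp
    ultimately have "\<exists>\<^sub>F n in sequentially. empirical T x n \<in> P.mball \<mu> (e / 2) \<and>
        rho F (empirical T x n) (empirical T y n) < e / 2 \<and> n > 0"
      by (rule frequently_eventually_frequently)
    then show ?thesis
    proof (rule frequently_elim1)
      fix n assume n: "empirical T x n \<in> P.mball \<mu> (e / 2) \<and>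
        rho F (empirical T x n) (empirical T y n) < e / 2 \<and> n > 0"
      then have "rho F \<mu> (empirical T y n) < e"
        using P.triangle[of \<mu> "empirical T x n" "empirical T y n"] \<mu>P empirical_prob[of n T]
        by (auto simp: P.in_mball)
      then show "empirical T y n \<in> W"
        using e(2) \<mu>P n empirical_prob[of n T y] by (auto simp: P.in_mball)
    qed
  qed
  then show "\<mu> \<in> V T y"
    using \<mu>P by (simp add: V_def)
qed

lemma V_shift: "V T (T x) = V T x"
proof -
  have small: "\<forall>\<^sub>F n in sequentially. rho F (empirical T x n) (empirical T (T x) n) < e"
    if "e > 0" for e
  proof -
    have "(\<lambda>n. 2 / real n) \<longlonglongrightarrow> 0"
      by (rule lim_const_over_n)
    then have "\<forall>\<^sub>F n in sequentially. 2 / real n < e"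
      using that by (simp add: order_tendstoD(2))
    then show ?thesis
      using eventually_gt_at_top[of 0]
      by eventually_elim (rule le_less_trans[OF rho_empirical_shift])
  qed
  moreover have "\<forall>\<^sub>F n in sequentially. rho F (empirical T (T x) n) (empirical T x n) < e"
    if "e > 0" for e
    using small[OF that] by (simp add: P.commute)
  ultimately show ?thesis
    using V_subset_of_asymptotic[of x "T x"] V_subset_of_asymptotic[of "T x" x] by blast
qed

end

section \<open>Orbit averages and functions that separate two measures\<close>

text \<open>The averages of \<open>f\<close> along the orbit are the integrals of \<open>f\<close> against the empirical measures, so they
  come arbitrarily close to \<open>\<integral>f d\<mu>\<close> infinitely often.\<close>

lemma V_averages_between:
  assumes "\<mu> \<in> V T x"
  shows "lower_avg T (apply_bcontfun f) x \<le> ereal (\<integral>y. apply_bcontfun f y \<partial>\<mu>)"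
    and "ereal (\<integral>y. apply_bcontfun f y \<partial>\<mu>) \<le> upper_avg T (apply_bcontfun f) x"
proof -
  have freq: "\<exists>\<^sub>F n in sequentially. birkhoff_avg T (apply_bcontfun f) x n \<in> U"
    if "open U" "(\<integral>y. apply_bcontfun f y \<partial>\<mu>) \<in> U" for U
  proof -
    have "\<exists>\<^sub>F n in sequentially. empirical T x n
        \<in> {\<nu> \<in> prob_measures. (\<integral>y. apply_bcontfun f y \<partial>\<nu>) \<in> U}"
      using assms openin_weak_star_integral[OF that(1), of f] that(2) by (auto simp: V_def)
    then show ?thesis
      by (rule frequently_elim1) (simp add: integral_empirical_bcontfun birkhoff_avg_def)
  qed
  show "lower_avg T (apply_bcontfun f) x \<le> ereal (\<integral>y. apply_bcontfun f y \<partial>\<mu>)"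
  proof (rule ccontr)
    assume "\<not> ?thesis"
    then obtain r where r: "ereal (\<integral>y. apply_bcontfun f y \<partial>\<mu>) < ereal r"
      "ereal r < lower_avg T (apply_bcontfun f) x"
      using ereal_dense2 not_le by metis
    have ev: "\<forall>\<^sub>F n in sequentially. ereal r < ereal (birkhoff_avg T (apply_bcontfun f) x n)"
      using less_LiminfD[OF r(2)[unfolded lower_avg_def]] .
    have "\<exists>\<^sub>F n in sequentially. birkhoff_avg T (apply_bcontfun f) x n \<in> {..<r}"
      using r(1) by (intro freq) auto
    from frequently_ex[OF frequently_eventually_frequently[OF this ev]] show False
      by auto
  qed
  show "ereal (\<integral>y. apply_bcontfun f y \<partial>\<mu>) \<le> upper_avg T (apply_bcontfun f) x"
  proof (rule ccontr)
    assume "\<not> ?thesis"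
    then obtain r where r: "ereal r < ereal (\<integral>y. apply_bcontfun f y \<partial>\<mu>)"
      "upper_avg T (apply_bcontfun f) x < ereal r"
      using ereal_dense2 not_le by metis
    have ev: "\<forall>\<^sub>F n in sequentially. ereal (birkhoff_avg T (apply_bcontfun f) x n) < ereal r"
      using Limsup_lessD[OF r(2)[unfolded upper_avg_def]] .
    have "\<exists>\<^sub>F n in sequentially. birkhoff_avg T (apply_bcontfun f) x n \<in> {r<..}"
      using r(1) by (intro freq) auto
    from frequently_ex[OF frequently_eventually_frequently[OF this ev]] show False
      by auto
  qed
qed

lemma integral_bcontfun_diff_le:
  fixes f g :: "'a::topological_space \<Rightarrow>\<^sub>C real"
  assumes "\<mu> \<in> prob_measures"
  shows "\<bar>(\<integral>y. apply_bcontfun f y \<partial>\<mu>) - (\<integral>y. apply_bcontfun g y \<partial>\<mu>)\<bar> \<le> dist f g"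
proof -
  interpret prob_space \<mu> using assms by (simp add: prob_measures_def)
  note [simp] = integrable_bcontfun[OF assms]
  have "\<bar>\<integral>y. apply_bcontfun f y - apply_bcontfun g y \<partial>\<mu>\<bar>
      \<le> (\<integral>y. \<bar>apply_bcontfun f y - apply_bcontfun g y\<bar> \<partial>\<mu>)"
    by (rule integral_abs_bound)
  also have "\<dots> \<le> (\<integral>y. dist f g \<partial>\<mu>)"
    using dist_bounded[of f _ g] by (intro integral_mono) (auto simp: dist_real_def)
  finally show ?thesis
    by (simp add: prob_space)
qed

lemma continuous_on_integral_bcontfun:
  assumes "\<mu> \<in> prob_measures"
  shows "continuous_on UNIV (\<lambda>f :: 'a::topological_space \<Rightarrow>\<^sub>C real. \<integral>y. apply_bcontfun f y \<partial>\<mu>)"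
  unfolding continuous_on_iff
proof (intro ballI allI impI)
  fix f :: "'a \<Rightarrow>\<^sub>C real" and e :: real assume "0 < e"
  then show "\<exists>d>0. \<forall>g\<in>UNIV. dist g f < d \<longrightarrow>
      dist (\<integral>y. apply_bcontfun g y \<partial>\<mu>) (\<integral>y. apply_bcontfun f y \<partial>\<mu>) < e"
    using integral_bcontfun_diff_le[OF assms, of _ f]
    by (intro exI[of _ e]) (auto simp: dist_real_def intro: le_less_trans)
qed

text \<open>A single separating function \<open>g\<close> is enough: adding a small multiple of \<open>g\<close> to a function that does
  not distinguish \<open>\<mu>\<close> from \<open>\<nu>\<close> makes it do so.\<close>

lemma open_dense_separating_functions:
  fixes \<mu> \<nu> :: "'a::topological_space measure" and g :: "'a \<Rightarrow>\<^sub>C real"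
  assumes P: "\<mu> \<in> prob_measures" "\<nu> \<in> prob_measures"
    and g: "(\<integral>y. apply_bcontfun g y \<partial>\<mu>) \<noteq> (\<integral>y. apply_bcontfun g y \<partial>\<nu>)"
  defines "\<UU> \<equiv> {f :: 'a \<Rightarrow>\<^sub>C real. (\<integral>y. apply_bcontfun f y \<partial>\<mu>) \<noteq> (\<integral>y. apply_bcontfun f y \<partial>\<nu>)}"
  shows "open \<UU>" "closure \<UU> = UNIV"
proof -
  show "open \<UU>"
    unfolding \<UU>_def
    by (intro open_Collect_neq continuous_on_integral_bcontfun P)
  have "f \<in> closure \<UU>" for f
  proof (cases "f \<in> \<UU>")
    case False
    define h where "h n = f + (1 / real (Suc n)) *\<^sub>R g" for n
    have int: "(\<integral>y. apply_bcontfun (h n) y \<partial>\<kappa>) =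
        (\<integral>y. apply_bcontfun f y \<partial>\<kappa>) + (1 / real (Suc n)) * (\<integral>y. apply_bcontfun g y \<partial>\<kappa>)"
      if "\<kappa> \<in> prob_measures" for \<kappa> n
      using integrable_bcontfun[OF that] by (simp add: h_def plus_bcontfun.rep_eq scaleR_bcontfun.rep_eq)
    have "h n \<in> \<UU>" for n
      using False g by (simp add: \<UU>_def int[OF P(1)] int[OF P(2)])
    moreover have "h \<longlonglongrightarrow> f + 0 *\<^sub>R g"
      unfolding h_def by (intro tendsto_intros LIMSEQ_Suc[OF lim_const_over_n])
    ultimately show ?thesis
      unfolding closure_sequential by auto
  qed (use closure_subset in blast)
  then show "closure \<UU> = UNIV" by blast
qed

section \<open>Physical-like measures\<close>

text \<open>Lebesgue measure in the charts is monotone on images only if they are measurable, and this is the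
  case because a chart is a homeomorphism onto an open set.\<close>

lemma chart_image_borel:
  assumes A: "manifold_atlas \<A>" "(U, \<phi>) \<in> \<A>" and S: "S \<in> sets borel"
  shows "\<phi> ` (S \<inter> U) \<in> sets borel"
proof -
  have op: "open (\<phi> ` U)" and hom: "homeomorphism U (\<phi> ` U) \<phi> (inv_into U \<phi>)"
    using A unfolding manifold_atlas_def by auto
  have "inv_into U \<phi> \<in> borel_measurable (restrict_space borel (\<phi> ` U))"
    using hom by (intro borel_measurable_continuous_on_restrict) (simp add: homeomorphism_def)
  from measurable_sets[OF this S]
  have "inv_into U \<phi> -` S \<inter> \<phi> ` U \<in> sets (restrict_space borel (\<phi> ` U))"
    by (simp add: space_restrict_space)
  moreover have "inv_into U \<phi> -` S \<inter> \<phi> ` U = \<phi> ` (S \<inter> U)"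
    using hom by (auto simp: homeomorphism_def)
  ultimately show ?thesis
    using op by (auto simp: sets_restrict_space_iff)
qed

lemma chart_image_open:
  assumes A: "manifold_atlas \<A>" "(U, \<phi>) \<in> \<A>" and Q: "open Q"
  shows "open (\<phi> ` (Q \<inter> U))"
proof -
  have op: "open (\<phi> ` U)" and hom: "homeomorphism U (\<phi> ` U) \<phi> (inv_into U \<phi>)"
    using A unfolding manifold_atlas_def by auto
  have "open (inv_into U \<phi> -` Q \<inter> \<phi> ` U)"
    using hom op Q continuous_on_open_vimage[OF op] by (auto simp: homeomorphism_def)
  moreover have "inv_into U \<phi> -` Q \<inter> \<phi> ` U = \<phi> ` (Q \<inter> U)"
    using hom by (auto simp: homeomorphism_def)
  ultimately show ?thesis by simp
qed

lemma positive_lebesgue_measure_mono: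
  assumes A: "manifold_atlas \<A>" and "positive_lebesgue_measure \<A> S" "S \<subseteq> S'" "S' \<in> sets borel"
  shows "positive_lebesgue_measure \<A> S'"
proof -
  obtain U \<phi> where U: "(U, \<phi>) \<in> \<A>" "emeasure lebesgue (\<phi> ` (S \<inter> U)) > 0"
    using assms(2) by (auto simp: positive_lebesgue_measure_def)
  have "\<phi> ` (S' \<inter> U) \<in> sets lebesgue"
    using chart_image_borel[OF A U(1) assms(4)] by simp
  then have "emeasure lebesgue (\<phi> ` (S \<inter> U)) \<le> emeasure lebesgue (\<phi> ` (S' \<inter> U))"
    using assms(3) by (intro emeasure_mono) auto
  with U show ?thesis
    unfolding positive_lebesgue_measure_def by (auto intro: less_le_trans)
qed

context compact_system
begin

text \<open>If \<open>\<mu>\<close> is within \<open>e / 2\<close> of \<open>\<nu>\<close>, then \<open>G_set F T \<mu> (e / 2)\<close> is contained in \<open>G_set F T \<nu> e\<close>; hence a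
  radius \<open>e\<close> showing that \<open>\<nu>\<close> is not physical-like excludes all \<open>\<mu>\<close> in that ball.\<close>

lemma closedin_physical_like:
  assumes A: "manifold_atlas \<A>"
  shows "closedin weak_star (physical_like F \<A> T)"
proof -
  let ?O = "physical_like F \<A> T"
  have "\<exists>e>0. P.mball \<nu> e \<subseteq> prob_measures - ?O" if \<nu>: "\<nu> \<in> prob_measures - ?O" for \<nu>
  proof -
    obtain e where e: "e > 0" "\<not> positive_lebesgue_measure \<A> (G_set F T \<nu> e)"
      using \<nu> by (auto simp: physical_like_def)
    have "\<mu> \<notin> ?O" if \<mu>: "\<mu> \<in> P.mball \<nu> (e / 2)" for \<mu>
    proof
      assume "\<mu> \<in> ?O"
      then have pos: "positive_lebesgue_measure \<A> (G_set F T \<mu> (e / 2))"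
        using e(1) by (simp add: physical_like_def)
      have P: "\<mu> \<in> prob_measures" "\<nu> \<in> prob_measures" and d: "rho F \<nu> \<mu> < e / 2"
        using \<mu> by (auto simp: P.in_mball)
      have "G_set F T \<mu> (e / 2) \<subseteq> G_set F T \<nu> e"
      proof
        fix x assume x: "x \<in> G_set F T \<mu> (e / 2)"
        show "x \<in> G_set F T \<nu> e"
          unfolding G_set_iff[OF P(2)]
        proof (intro allI impI)
          fix e' assume "e < e'"
          then have "e' - e / 2 > e / 2" by simp
          then obtain \<kappa> where \<kappa>: "\<kappa> \<in> V T x" "rho F \<mu> \<kappa> < e' - e / 2"
            using x unfolding G_set_iff[OF P(1)] by blast
          then have "rho F \<nu> \<kappa> < e'"
            using P.triangle[of \<nu> \<mu> \<kappa>] P d V_subset_prob_measures[of x] by auto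
          with \<kappa>(1) show "\<exists>\<nu>'\<in>V T x. rho F \<nu> \<nu>' < e'" by blast
        qed
      qed
      from positive_lebesgue_measure_mono[OF A pos this G_set_borel[OF P(2)]] e(2)
      show False by simp
    qed
    then have "P.mball \<nu> (e / 2) \<subseteq> prob_measures - ?O"
      by (auto simp: P.in_mball)
    then show ?thesis
      using e(1) by (intro exI[of _ "e / 2"]) simp
  qed
  then have "openin weak_star (prob_measures - ?O)"
    unfolding mtopology_weak_star[symmetric] P.openin_mtopology by auto
  moreover have "?O \<subseteq> prob_measures"
    by (auto simp: physical_like_def)
  ultimately show ?thesis
    by (simp add: closedin_def topspace_weak_star)
qed

text \<open>Every measure that is not physical-like has a ball such that the points accumulating in that ball
  form a Lebesgue null set, and countably many such balls cover all these measures. If \<open>V T y\<close> missed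
  the physical-like measures for all \<open>y\<close> in an open set \<open>Q\<close>, then, as \<open>V T y\<close> is nonempty, \<open>Q\<close> would be covered
  by countably many null sets, but in a chart \<open>Q\<close> is a nonempty open set.\<close>

lemma dense_V_meets_physical_like:
  fixes \<A> :: "('a set \<times> ('a \<Rightarrow> 'b::euclidean_space)) set"
  assumes A: "manifold_atlas \<A>"
  shows "closure {x. V T x \<inter> physical_like F \<A> T \<noteq> {}} = UNIV"
proof (rule ccontr)
  let ?O = "physical_like F \<A> T"
  define Q where "Q = - closure {x. V T x \<inter> ?O \<noteq> {}}"
  assume "closure {x. V T x \<inter> ?O \<noteq> {}} \<noteq> UNIV"
  then obtain x where x: "x \<in> Q" by (auto simp: Q_def)
  have "open Q" by (simp add: Q_def open_Compl)
  have Q: "V T y \<inter> ?O = {}" if "y \<in> Q" for y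
    using that closure_subset[of "{x. V T x \<inter> ?O \<noteq> {}}"] by (auto simp: Q_def)
  have "(\<Union>(U, \<phi>)\<in>\<A>. U) = UNIV"
    using A by (simp add: manifold_atlas_def)
  then obtain U \<phi> where U: "(U, \<phi>) \<in> \<A>" "x \<in> U" by blast
  have "\<exists>e>0. \<not> positive_lebesgue_measure \<A> (G_set F T \<mu> e)" if "\<mu> \<in> prob_measures - ?O" for \<mu>
    using that by (auto simp: physical_like_def)
  then obtain e where e: "\<And>\<mu>. \<mu> \<in> prob_measures - ?O \<Longrightarrow> e \<mu> > 0"
      "\<And>\<mu>. \<mu> \<in> prob_measures - ?O \<Longrightarrow> \<not> positive_lebesgue_measure \<A> (G_set F T \<mu> (e \<mu>))"
    by metis
  obtain \<B> :: "'a measure set set" where \<B>: "countable \<B>"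
      "\<And>W \<mu>. openin weak_star W \<Longrightarrow> \<mu> \<in> W \<Longrightarrow> \<exists>B\<in>\<B>. \<mu> \<in> B \<and> B \<subseteq> W"
    using second_countable_weak_star[OF compact_UNIV metrizing] unfolding second_countable_def by metis
  define \<B>' where "\<B>' = {B \<in> \<B>. \<exists>\<mu>\<in>prob_measures - ?O. B \<subseteq> P.mball \<mu> (e \<mu>)}"
  have "\<exists>\<mu>. \<mu> \<in> prob_measures - ?O \<and> B \<subseteq> P.mball \<mu> (e \<mu>)" if "B \<in> \<B>'" for B
    using that by (auto simp: \<B>'_def)
  then obtain c where c: "\<And>B. B \<in> \<B>' \<Longrightarrow> c B \<in> prob_measures - ?O"
      "\<And>B. B \<in> \<B>' \<Longrightarrow> B \<subseteq> P.mball (c B) (e (c B))"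
    by metis
  let ?G = "\<lambda>B. G_set F T (c B) (e (c B))"
  have cover: "Q \<inter> U \<subseteq> (\<Union>B\<in>\<B>'. ?G B \<inter> U)"
  proof
    fix y assume y: "y \<in> Q \<inter> U"
    obtain \<nu> where \<nu>: "\<nu> \<in> V T y"
      using V_nonempty[of y] by blast
    then have \<nu>': "\<nu> \<in> prob_measures - ?O"
      using V_subset_prob_measures Q[of y] y by blast
    then have "\<nu> \<in> P.mball \<nu> (e \<nu>)"
      using e(1) by simp
    then obtain B where B: "B \<in> \<B>" "\<nu> \<in> B" "B \<subseteq> P.mball \<nu> (e \<nu>)"
      using \<B>(2)[OF openin_mball_weak_star] by blast
    then have B': "B \<in> \<B>'"
      using \<nu>' by (auto simp: \<B>'_def)
    then have "rho F (c B) \<nu> < e (c B)"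
      using c(2)[OF B'] B(2) by (auto simp: P.in_mball)
    then have "y \<in> ?G B"
      using c(1)[OF B'] \<nu> by (auto simp: G_set_iff intro: less_trans)
    then show "y \<in> (\<Union>B\<in>\<B>'. ?G B \<inter> U)"
      using y B' by blast
  qed
  have "(\<Union>B\<in>\<B>'. \<phi> ` (?G B \<inter> U)) \<in> null_sets lebesgue"
  proof (rule null_sets_UN')
    show "countable \<B>'" using \<B>(1) by (simp add: \<B>'_def)
    fix B assume B: "B \<in> \<B>'"
    have "\<phi> ` (?G B \<inter> U) \<in> sets lebesgue"
      using chart_image_borel[OF A U(1) G_set_borel] c(1)[OF B] by simp
    moreover have "emeasure lebesgue (\<phi> ` (?G B \<inter> U)) = 0"
      using e(2)[OF c(1)[OF B]] U(1) by (auto simp: positive_lebesgue_measure_def)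
    ultimately show "\<phi> ` (?G B \<inter> U) \<in> null_sets lebesgue" by blast
  qed
  moreover have "\<phi> ` (Q \<inter> U) \<subseteq> (\<Union>B\<in>\<B>'. \<phi> ` (?G B \<inter> U))"
    using cover by blast
  ultimately have "negligible (\<phi> ` (Q \<inter> U))"
    using negligible_subset negligible_iff_null_sets by blast
  moreover have "open (\<phi> ` (Q \<inter> U))"
    by (rule chart_image_open[OF A U(1) \<open>open Q\<close>])
  moreover have "\<phi> ` (Q \<inter> U) \<noteq> {}"
    using x U(2) by blast
  ultimately show False
    using open_not_negligible by blast
qed

section \<open>Generic points\<close>

text \<open>This is the only use of the density that defines \<open>M_dense\<close>: an open neighbourhood of \<open>\<mu>\<close> contains a
  ball, and the points of \<open>G_set\<close> for half the radius accumulate inside it.\<close>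

lemma dense_V_meets_open:
  assumes "\<mu> \<in> M_dense F T" "openin weak_star W" "\<mu> \<in> W"
  shows "closure {x. V T x \<inter> W \<noteq> {}} = UNIV"
proof -
  have \<mu>: "\<mu> \<in> prob_measures"
    using assms(1) by (simp add: M_dense_def invariant_measures_def)
  obtain e where e: "e > 0" "P.mball \<mu> e \<subseteq> W"
    using assms(2,3) unfolding mtopology_weak_star[symmetric] P.openin_mtopology by blast
  have "G_set F T \<mu> (e / 2) \<subseteq> {x. V T x \<inter> W \<noteq> {}}"
  proof
    fix x assume "x \<in> G_set F T \<mu> (e / 2)"
    then obtain \<nu> where "\<nu> \<in> V T x" "rho F \<mu> \<nu> < e"
      using e(1) unfolding G_set_iff[OF \<mu>] by (auto dest: spec[of _ e])
    moreover from this have "\<nu> \<in> W"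
      using e(2) \<mu> V_subset_prob_measures[of x] by (auto simp: P.in_mball subset_iff)
    ultimately show "x \<in> {x. V T x \<inter> W \<noteq> {}}"
      by blast
  qed
  from closure_mono[OF this] show ?thesis
    using assms(1) e(1) by (auto simp: M_dense_def)
qed

text \<open>Both conditions come from visits to countably many open sets. To accumulate at each measure in
  \<open>M_dense\<close> it suffices to visit each basic set that meets \<open>M_dense\<close> infinitely often. To accumulate
  somewhere on the compact set of physical-like measures it suffices to visit each of its
  neighbourhoods infinitely often, and by compactness finite unions of basic sets are enough
  neighbourhoods.\<close>

lemma residual_V:
  fixes \<A> :: "('a set \<times> ('a \<Rightarrow> 'b::euclidean_space)) set"
  shows "residual {x. M_dense F T \<subseteq> V T x \<and>
    (manifold_atlas \<A> \<longrightarrow> V T x \<inter> physical_like F \<A> T \<noteq> {})}"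
proof -
  let ?O = "physical_like F \<A> T"
  obtain \<B> :: "'a measure set set" where \<B>: "countable \<B>" "\<And>B. B \<in> \<B> \<Longrightarrow> openin weak_star B"
      "\<And>W \<mu>. openin weak_star W \<Longrightarrow> \<mu> \<in> W \<Longrightarrow> \<exists>B\<in>\<B>. \<mu> \<in> B \<and> B \<subseteq> W"
    using second_countable_weak_star[OF compact_UNIV metrizing] unfolding second_countable_def by metis
  define \<W>\<^sub>1 where "\<W>\<^sub>1 = {B \<in> \<B>. B \<inter> M_dense F T \<noteq> {}}"
  define \<W>\<^sub>2 where "\<W>\<^sub>2 = {W \<in> Union ` {\<F>. finite \<F> \<and> \<F> \<subseteq> \<B>}. manifold_atlas \<A> \<and> ?O \<subseteq> W}"
  have "residual {x. \<forall>W\<in>\<W>\<^sub>1 \<union> \<W>\<^sub>2. \<exists>\<^sub>F n in sequentially. empirical T x n \<in> W}"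
  proof (rule residual_visits)
    have "countable {\<F>. finite \<F> \<and> \<F> \<subseteq> \<B>}"
      by (rule countable_Collect_finite_subset[OF \<B>(1)])
    then show "countable (\<W>\<^sub>1 \<union> \<W>\<^sub>2)"
      using \<B>(1) by (simp add: \<W>\<^sub>1_def \<W>\<^sub>2_def)
    show op: "openin weak_star W" if "W \<in> \<W>\<^sub>1 \<union> \<W>\<^sub>2" for W
      using that \<B>(2) by (auto simp: \<W>\<^sub>1_def \<W>\<^sub>2_def)
    fix W assume W: "W \<in> \<W>\<^sub>1 \<union> \<W>\<^sub>2"
    show "closure {x. V T x \<inter> W \<noteq> {}} = UNIV"
    proof (cases "W \<in> \<W>\<^sub>1")
      case True
      then show ?thesis
        using dense_V_meets_open op[OF W] by (auto simp: \<W>\<^sub>1_def)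
    next
      case False
      then have "manifold_atlas \<A>" "?O \<subseteq> W"
        using W by (auto simp: \<W>\<^sub>2_def)
      then show ?thesis
        using closure_mono[of "{x. V T x \<inter> ?O \<noteq> {}}" "{x. V T x \<inter> W \<noteq> {}}"]
          dense_V_meets_physical_like[of \<A>] by auto
    qed
  qed
  moreover have "{x. \<forall>W\<in>\<W>\<^sub>1 \<union> \<W>\<^sub>2. \<exists>\<^sub>F n in sequentially. empirical T x n \<in> W}
      \<subseteq> {x. M_dense F T \<subseteq> V T x \<and> (manifold_atlas \<A> \<longrightarrow> V T x \<inter> ?O \<noteq> {})}"
  proof (intro subsetI CollectI conjI impI)
    fix x assume "x \<in> {x. \<forall>W\<in>\<W>\<^sub>1 \<union> \<W>\<^sub>2. \<exists>\<^sub>F n in sequentially. empirical T x n \<in> W}"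
    then have freq: "\<exists>\<^sub>F n in sequentially. empirical T x n \<in> W" if "W \<in> \<W>\<^sub>1 \<union> \<W>\<^sub>2" for W
      using that by simp
    show "\<mu> \<in> V T x" if \<mu>: "\<mu> \<in> M_dense F T" for \<mu>
      unfolding V_def
    proof (intro CollectI conjI allI impI)
      show "\<mu> \<in> prob_measures"
        using \<mu> by (simp add: M_dense_def invariant_measures_def)
      fix W assume "openin weak_star W \<and> \<mu> \<in> W"
      then obtain B where B: "B \<in> \<B>" "\<mu> \<in> B" "B \<subseteq> W"
        using \<B>(3) by blast
      then have "B \<in> \<W>\<^sub>1"
        using \<mu> by (auto simp: \<W>\<^sub>1_def)
      then show "\<exists>\<^sub>F n in sequentially. empirical T x n \<in> W"
        using freq[of B] B(3) by (auto elim: frequently_elim1)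
    qed
    assume A: "manifold_atlas \<A>"
    have comp: "compactin weak_star ?O"
      by (rule compactin_weak_star_closed[OF closedin_physical_like[OF A]])
    then show "V T x \<inter> ?O \<noteq> {}"
    proof (rule V_meets_compact)
      fix W assume W: "openin weak_star W" "?O \<subseteq> W"
      have "?O \<subseteq> \<Union>{B \<in> \<B>. B \<subseteq> W}"
        using \<B>(3)[OF W(1)] W(2) by blast
      then obtain \<F> where \<F>: "finite \<F>" "\<F> \<subseteq> {B \<in> \<B>. B \<subseteq> W}" "?O \<subseteq> \<Union>\<F>"
        using compactinD[OF comp, of "{B \<in> \<B>. B \<subseteq> W}"] \<B>(2) by auto
      have "\<Union>\<F> \<in> \<W>\<^sub>2"
        unfolding \<W>\<^sub>2_def using A \<F> by auto
      then show "\<exists>\<^sub>F n in sequentially. empirical T x n \<in> W"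
        using freq[of "\<Union>\<F>"] \<F>(2) by (auto elim!: frequently_elim1)
    qed
  qed
  ultimately show ?thesis
    unfolding residual_def by (meson subset_trans)
qed

lemma metrizing_family_separates:
  assumes "\<mu> \<in> prob_measures" "\<nu> \<in> prob_measures" "\<mu> \<noteq> \<nu>"
  obtains i where "(\<integral>y. apply_bcontfun (F i) y \<partial>\<mu>) \<noteq> (\<integral>y. apply_bcontfun (F i) y \<partial>\<nu>)"
proof (rule ccontr)
  assume "\<not> thesis"
  then have "(\<integral>y. apply_bcontfun (F i) y \<partial>\<mu>) = (\<integral>y. apply_bcontfun (F i) y \<partial>\<nu>)" for i
    using that by blast
  then have "rho F \<mu> \<nu> = 0"
    by (simp add: rho_def)
  then show False
    using assms P.zero by blast
qed

end

theorem theorem1: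
  fixes T :: "'a::metric_space \<Rightarrow> 'a"
    and F :: "nat \<Rightarrow> ('a \<Rightarrow>\<^sub>C real)"
    and \<A> :: "('a set \<times> ('a \<Rightarrow> 'b::euclidean_space)) set"
  assumes "compact (UNIV :: 'a set)"
    and "continuous_on UNIV T"
    and "metrizing_family F"
    and "\<exists>\<mu>\<in>M_dense F T. \<exists>\<nu>\<in>M_dense F T. \<mu> \<noteq> \<nu>"
  shows "\<exists>(Y :: 'a set) (\<UU> :: ('a \<Rightarrow>\<^sub>C real) set).
    residual Y \<and> T -` Y = Y \<and> open \<UU> \<and> closure \<UU> = UNIV \<and>
    (\<forall>x\<in>Y. \<forall>f\<in>\<UU>.
       M_dense F T \<subseteq> V T x \<and>
       lower_avg T (apply_bcontfun f) x
         \<le> (INF \<mu>\<in>M_dense F T. ereal (\<integral>y. apply_bcontfun f y \<partial>\<mu>)) \<and>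
       (INF \<mu>\<in>M_dense F T. ereal (\<integral>y. apply_bcontfun f y \<partial>\<mu>))
         < (SUP \<mu>\<in>M_dense F T. ereal (\<integral>y. apply_bcontfun f y \<partial>\<mu>)) \<and>
       (SUP \<mu>\<in>M_dense F T. ereal (\<integral>y. apply_bcontfun f y \<partial>\<mu>))
         \<le> upper_avg T (apply_bcontfun f) x \<and>
       (manifold_atlas \<A> \<longrightarrow> V T x \<inter> physical_like F \<A> T \<noteq> {}))"
proof -
  interpret compact_system T F
    using assms(1-3) by unfold_locales
  obtain \<mu> \<nu> where \<mu>\<nu>: "\<mu> \<in> M_dense F T" "\<nu> \<in> M_dense F T" "\<mu> \<noteq> \<nu>"
    using assms(4) by blast
  then have P: "\<mu> \<in> prob_measures" "\<nu> \<in> prob_measures"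
    by (auto simp: M_dense_def invariant_measures_def)
  obtain i where i: "(\<integral>y. apply_bcontfun (F i) y \<partial>\<mu>) \<noteq> (\<integral>y. apply_bcontfun (F i) y \<partial>\<nu>)"
    using metrizing_family_separates[OF P \<mu>\<nu>(3)] .
  define Y where "Y = {x. M_dense F T \<subseteq> V T x \<and>
    (manifold_atlas \<A> \<longrightarrow> V T x \<inter> physical_like F \<A> T \<noteq> {})}"
  define \<UU> where "\<UU> = {f :: 'a \<Rightarrow>\<^sub>C real.
    (\<integral>y. apply_bcontfun f y \<partial>\<mu>) \<noteq> (\<integral>y. apply_bcontfun f y \<partial>\<nu>)}"
  show ?thesis
  proof (intro exI[of _ Y] exI[of _ \<UU>] conjI ballI)
    show "residual Y"
      unfolding Y_def by (rule residual_V)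
    show "T -` Y = Y"
      by (simp add: Y_def V_shift)
    show "open \<UU>" "closure \<UU> = UNIV"
      unfolding \<UU>_def by (rule open_dense_separating_functions[OF P i])+
    fix x f assume x: "x \<in> Y" and f: "f \<in> \<UU>"
    show sub: "M_dense F T \<subseteq> V T x"
      and "manifold_atlas \<A> \<longrightarrow> V T x \<inter> physical_like F \<A> T \<noteq> {}"
      using x by (auto simp: Y_def)
    let ?I = "\<lambda>\<mu>. ereal (\<integral>y. apply_bcontfun f y \<partial>\<mu>)"
    show "lower_avg T (apply_bcontfun f) x \<le> (INF \<mu>\<in>M_dense F T. ?I \<mu>)"
      using sub by (intro INF_greatest V_averages_between(1)) auto
    show "(SUP \<mu>\<in>M_dense F T. ?I \<mu>) \<le> upper_avg T (apply_bcontfun f) x"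
      using sub by (intro SUP_least V_averages_between(2)) auto
    have "?I \<mu> < ?I \<nu> \<or> ?I \<nu> < ?I \<mu>"
      using f by (auto simp: \<UU>_def)
    then obtain \<mu>' \<nu>' where "\<mu>' \<in> M_dense F T" "\<nu>' \<in> M_dense F T" "?I \<mu>' < ?I \<nu>'"
      using \<mu>\<nu>(1,2) by blast
    then show "(INF \<mu>\<in>M_dense F T. ?I \<mu>) < (SUP \<mu>\<in>M_dense F T. ?I \<mu>)"
      by (meson INF_lower SUP_upper le_less_trans less_le_trans)
  qed
qed

end
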